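(* In the dyadic simulation tree described in the context, assume that the random variables $S^0_0$ and $C^l_i$ ($0\le l\le m-1$, $0\le i<2^l$) are all mutually independent. Then for every $l$ with $1\le l\le m$, the $2^l$ random variables $S^l_0,S^l_1,\dots,S^l_{2^l-1}$ are i.i.d. with distribution $X^{*(U/2^l)}$.
   Context: Let $m\ge1$ and $U=2^m$. Let $X$ be a probability distribution on $\mathbb{R}$; for $n\ge1$, $X^{*n}$ denotes its $n$-fold convolution power (the law of the sum of $n$ i.i.d. $X$-distributed random variables). Let $(E,\mathcal{E})$ be a measurable space with a probability measure $\nu$. For each $n\in\{1,2,4,\dots,U/2\}$ let $\theta_n:E\times\mathbb{R}\to\mathbb{R}$ be a measurable function with the following splitting property: whenever $S$ has law $X^{*2n}$ and $C$ has law $\nu$ and is independent of $S$, the random variables $\theta_n(C,S)$ and $S-\theta_n(C,S)$ are independent and each has law $X^{*n}$. Dyadic simulation tree: let $S^0_0$ be a random variable with law $X^{*U}$ and let $C^l_i$ ($0\le l\le m-1$, $0\le i<2^l$) be $E$-valued random variables each with law $\nu$. Define recursively, for $l=0,\dots,m-1$ and $0\le i<2^l$, $S^{l+1}_{2i}=\theta_{U/2^{l+1}}(C^l_i,S^l_i)$ and $S^{l+1}_{2i+1}=S^l_i-S^{l+1}_{2i}$. (The variable $S^l_i$ is the range-sum attached to the dyadic range $[iU/2^l,(i+1)U/2^l)$.) *)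

theory Defs
  imports "HOL-Probability.Probability"
begin

primrec conv_power :: "real measure \<Rightarrow> nat \<Rightarrow> real measure" where
  "conv_power X 0 = return borel 0"
| "conv_power X (Suc n) = convolution X (conv_power X n)"

definition has_law :: "'w measure \<Rightarrow> ('w \<Rightarrow> 'a) \<Rightarrow> 'a measure \<Rightarrow> bool" where
  "has_law P Y L \<longleftrightarrow> Y \<in> measurable P L \<and> distr P L Y = L"

text \<open>The library predicates \<open>indep_var\<close> and \<open>indep_vars\<close> force all variables to have the same
  value type. For families mixing \<open>E\<close>-valued and real variables, independence is stated with
  \<open>indep_set\<close> and \<open>indep_sets\<close> on the following set systems, exactly as in \<open>indep_vars_def2\<close>.\<close>

definition rv_events :: "'w measure \<Rightarrow> 'a measure \<Rightarrow> ('w \<Rightarrow> 'a) \<Rightarrow> 'w set set" where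
  "rv_events P N Y = {Y -` A \<inter> space P | A. A \<in> sets N}"

text \<open>HOL cannot quantify over the type of the sample space inside a formula, so the probability
  spaces \<open>P\<close> below live on the type \<open>'e \<times> real\<close>. This is no restriction: lemma
  \<open>splitting_any_space\<close> derives the property for probability spaces over an arbitrary type.\<close>

definition splitting :: "real measure \<Rightarrow> 'e measure \<Rightarrow> nat \<Rightarrow> ('e \<Rightarrow> real \<Rightarrow> real) \<Rightarrow> bool" where
  "splitting X \<nu> n t \<longleftrightarrow>
    (\<forall>(P :: ('e \<times> real) measure) C S.
      prob_space P \<and> has_law P S (conv_power X (2 * n)) \<and> has_law P C \<nu> \<and>
      prob_space.indep_set P (rv_events P \<nu> C) (rv_events P borel S) \<longrightarrow>
      prob_space.indep_var P borel (\<lambda>\<omega>. t (C \<omega>) (S \<omega>)) borel (\<lambda>\<omega>. S \<omega> - t (C \<omega>) (S \<omega>)) \<and>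
      has_law P (\<lambda>\<omega>. t (C \<omega>) (S \<omega>)) (conv_power X n) \<and>
      has_law P (\<lambda>\<omega>. S \<omega> - t (C \<omega>) (S \<omega>)) (conv_power X n))"

lemma sets_conv_power [simp, measurable_cong]: "sets (conv_power X n) = sets borel"
  by (cases n) simp_all

lemma conv_power_1:
  assumes "prob_space X" "sets X = sets borel"
  shows "conv_power X 1 = X"
proof -
  interpret X: prob_space X by fact
  interpret R: prob_space "return borel (0::real)" by (rule prob_space_return) simp
  interpret pair_prob_space X "return borel (0::real)" ..
  note [measurable_cong] = assms(2)
  show ?thesis
  proof (rule measure_eqI)
    fix A assume A: "A \<in> sets (conv_power X 1)"
    then have [measurable]: "A \<in> sets borel" by simp
    have "emeasure (conv_power X 1) A = (\<integral>\<^sup>+x. indicator A x \<partial>conv_power X 1)"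
      using A by simp
    also have "\<dots> = (\<integral>\<^sup>+x. \<integral>\<^sup>+y. indicator A (x + y) \<partial>return borel 0 \<partial>X)"
      using assms by (simp add: nn_integral_convolution X.finite_measure_axioms R.finite_measure_axioms del: nn_integral_indicator)
    also have "\<dots> = (\<integral>\<^sup>+x. indicator A x \<partial>X)"
      by (simp add: nn_integral_return del: nn_integral_indicator)
    also have "\<dots> = emeasure X A" using assms(2) by simp
    finally show "emeasure (conv_power X 1) A = emeasure X A" .
  qed (simp add: assms(2))
qed

lemma splitting_any_space:
  fixes P :: "'w measure" and X :: "real measure" and \<nu> :: "'e measure"
  assumes split: "splitting X \<nu> n t"
    and t: "(\<lambda>(c, s). t c s) \<in> borel_measurable (\<nu> \<Otimes>\<^sub>M borel)"
    and P: "prob_space P"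
    and S: "has_law P S (conv_power X (2 * n))" and C: "has_law P C \<nu>"
    and ind: "prob_space.indep_set P (rv_events P \<nu> C) (rv_events P borel S)"
  shows "prob_space.indep_var P borel (\<lambda>\<omega>. t (C \<omega>) (S \<omega>)) borel (\<lambda>\<omega>. S \<omega> - t (C \<omega>) (S \<omega>))"
    and "has_law P (\<lambda>\<omega>. t (C \<omega>) (S \<omega>)) (conv_power X n)"
    and "has_law P (\<lambda>\<omega>. S \<omega> - t (C \<omega>) (S \<omega>)) (conv_power X n)"
proof -
  interpret P: prob_space P by fact
  let ?L = "conv_power X (2 * n)"
  have [measurable]: "S \<in> measurable P ?L" "S \<in> borel_measurable P" "C \<in> measurable P \<nu>"
    using S C by (auto simp: has_law_def cong: measurable_cong_sets)
  have dS: "distr P ?L S = ?L" and dC: "distr P \<nu> C = \<nu>"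
    using S C by (auto simp: has_law_def)
  interpret N: prob_space \<nu> using P.prob_space_distr[of C \<nu>] dC by simp
  interpret L: prob_space ?L using P.prob_space_distr[of S ?L] dS by simp
  interpret NL: pair_prob_space \<nu> ?L ..
  define Q where "Q = \<nu> \<Otimes>\<^sub>M ?L"
  have setsQ [measurable_cong]: "sets Q = sets (\<nu> \<Otimes>\<^sub>M borel)"
    unfolding Q_def by (intro sets_pair_measure_cong) simp_all
  have Q: "prob_space Q" unfolding Q_def by (rule NL.prob_space_axioms)
  interpret Q: prob_space Q by fact
  note t [measurable]
  have joint: "distr P Q (\<lambda>\<omega>. (C \<omega>, S \<omega>)) = Q"
  proof -
    have "\<nu> \<Otimes>\<^sub>M ?L = distr P Q (\<lambda>\<omega>. (C \<omega>, S \<omega>))"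
    proof (rule pair_measure_eqI)
      fix A B assume [measurable]: "A \<in> sets \<nu>" and B: "B \<in> sets ?L"
      then have [measurable]: "B \<in> sets borel" by simp
      have "emeasure \<nu> A * emeasure ?L B
          = emeasure (distr P \<nu> C) A * emeasure (distr P ?L S) B" by (simp add: dS dC)
      also have "\<dots> = emeasure P (C -` A \<inter> space P) * emeasure P (S -` B \<inter> space P)"
        using B by (simp add: emeasure_distr)
      also have "\<dots> = emeasure P ((C -` A \<inter> space P) \<inter> (S -` B \<inter> space P))"
      proof -
        have "C -` A \<inter> space P \<in> rv_events P \<nu> C" "S -` B \<inter> space P \<in> rv_events P borel S"
          using \<open>A \<in> sets \<nu>\<close> \<open>B \<in> sets borel\<close> unfolding rv_events_def by blast+
        from P.indep_setD[OF ind this] show ?thesis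
          by (simp add: P.emeasure_eq_measure ennreal_mult[symmetric])
      qed
      also have "\<dots> = emeasure P ((\<lambda>\<omega>. (C \<omega>, S \<omega>)) -` (A \<times> B) \<inter> space P)"
        by (intro arg_cong[where f="emeasure P"]) auto
      also have "\<dots> = emeasure (distr P Q (\<lambda>\<omega>. (C \<omega>, S \<omega>))) (A \<times> B)"
        by (subst emeasure_distr) auto
      finally show "emeasure \<nu> A * emeasure ?L B = emeasure (distr P Q (\<lambda>\<omega>. (C \<omega>, S \<omega>))) (A \<times> B)" .
    qed (simp_all add: Q_def N.sigma_finite_measure_axioms L.sigma_finite_measure_axioms)
    then show ?thesis by (simp add: Q_def)
  qed
  have Qfst: "has_law Q fst \<nu>"
    unfolding has_law_def Q_def by (simp add: L.distr_pair_fst)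
  have snd_law: "distr Q ?L snd = ?L"
  proof -
    have "distr Q ?L snd = distr (distr P Q (\<lambda>\<omega>. (C \<omega>, S \<omega>))) ?L snd" by (simp add: joint)
    also have "\<dots> = distr P ?L (snd \<circ> (\<lambda>\<omega>. (C \<omega>, S \<omega>)))" by (intro distr_distr) simp_all
    finally show ?thesis by (simp add: dS o_def)
  qed
  have Qsnd: "has_law Q snd ?L" unfolding has_law_def using snd_law by simp
  have Qind: "Q.indep_set (rv_events Q \<nu> fst) (rv_events Q borel snd)"
    unfolding Q.indep_sets2_eq
  proof (intro conjI ballI)
    show "rv_events Q \<nu> fst \<subseteq> Q.events" "rv_events Q borel snd \<subseteq> Q.events"
      by (auto simp: rv_events_def)
    fix a b assume "a \<in> rv_events Q \<nu> fst" "b \<in> rv_events Q borel snd"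
    then obtain A B where [measurable]: "A \<in> sets \<nu>" "B \<in> sets borel"
      and ab: "a = fst -` A \<inter> space Q" "b = snd -` B \<inter> space Q"
      by (auto simp: rv_events_def)
    have sp: "A \<subseteq> space \<nu>" by (rule sets.sets_into_space) fact
    have [simp]: "space ?L = UNIV" using sets_eq_imp_space_eq[OF sets_conv_power] by simp
    have "a = A \<times> space ?L" "b = space \<nu> \<times> B" "a \<inter> b = A \<times> B"
      using sp by (auto simp: ab Q_def space_pair_measure)
    moreover have "measure Q (A' \<times> B') = measure \<nu> A' * measure ?L B'"
      if "A' \<in> sets \<nu>" "B' \<in> sets borel" for A' B'
      using that unfolding Q_def measure_def
      by (simp add: L.emeasure_pair_measure_Times enn2real_mult)
    ultimately show "Q.prob (a \<inter> b) = Q.prob a * Q.prob b"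
      using N.prob_space L.prob_space by simp
  qed
  have r: "Q.indep_var borel (\<lambda>\<omega>. t (fst \<omega>) (snd \<omega>)) borel (\<lambda>\<omega>. snd \<omega> - t (fst \<omega>) (snd \<omega>))"
    "has_law Q (\<lambda>\<omega>. t (fst \<omega>) (snd \<omega>)) (conv_power X n)"
    "has_law Q (\<lambda>\<omega>. snd \<omega> - t (fst \<omega>) (snd \<omega>)) (conv_power X n)"
    using split Q Qfst Qsnd Qind unfolding splitting_def by blast+
  have tr: "distr P M (\<lambda>\<omega>. f (C \<omega>, S \<omega>)) = distr Q M f" if "f \<in> measurable Q M"
    for f :: "'e \<times> real \<Rightarrow> 'z" and M
  proof -
    have "distr Q M f = distr (distr P Q (\<lambda>\<omega>. (C \<omega>, S \<omega>))) M f" by (simp add: joint)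
    also have "\<dots> = distr P M (f \<circ> (\<lambda>\<omega>. (C \<omega>, S \<omega>)))" using that by (intro distr_distr) simp_all
    finally show ?thesis by (simp add: o_def)
  qed
  have tm [measurable]: "(\<lambda>\<omega>. t (fst \<omega>) (snd \<omega>)) \<in> borel_measurable Q"
    using t by (simp add: split_beta' cong: measurable_cong_sets)
  have pm: "(\<lambda>\<omega>. (C \<omega>, S \<omega>)) \<in> measurable P Q" by simp
  have tP [measurable]: "(\<lambda>\<omega>. t (C \<omega>) (S \<omega>)) \<in> borel_measurable P"
    using measurable_compose[OF pm tm] by simp
  have sQ [measurable]: "snd \<in> borel_measurable Q" by simp
  show "P.indep_var borel (\<lambda>\<omega>. t (C \<omega>) (S \<omega>)) borel (\<lambda>\<omega>. S \<omega> - t (C \<omega>) (S \<omega>))"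
    using r(1) tr[of "\<lambda>\<omega>. t (fst \<omega>) (snd \<omega>)" borel]
      tr[of "\<lambda>\<omega>. snd \<omega> - t (fst \<omega>) (snd \<omega>)" borel]
      tr[of "\<lambda>\<omega>. (t (fst \<omega>) (snd \<omega>), snd \<omega> - t (fst \<omega>) (snd \<omega>))" "borel \<Otimes>\<^sub>M borel"]
    unfolding P.indep_var_distribution_eq Q.indep_var_distribution_eq by simp
  show "has_law P (\<lambda>\<omega>. t (C \<omega>) (S \<omega>)) (conv_power X n)"
    using r(2) tr[of "\<lambda>\<omega>. t (fst \<omega>) (snd \<omega>)" "conv_power X n"]
    unfolding has_law_def by simp
  show "has_law P (\<lambda>\<omega>. S \<omega> - t (C \<omega>) (S \<omega>)) (conv_power X n)"
    using r(3) tr[of "\<lambda>\<omega>. snd \<omega> - t (fst \<omega>) (snd \<omega>)" "conv_power X n"]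
    unfolding has_law_def by simp
qed

end

theory Submission
  imports Defs
begin

text \<open>By induction on the level \<open>l\<close>, the variables \<open>S\<^sup>l\<^sub>i\<close> together with all random sources
  \<open>C\<^sup>k\<^sub>i\<close> of the levels \<open>k \<ge> l\<close> that have not been used yet form an independent family. For the
  step, group \<open>S\<^sup>l\<^sub>i\<close> with \<open>C\<^sup>l\<^sub>i\<close>: the generated \<open>\<sigma>\<close>-algebras are independent, the children of
  node \<open>i\<close> are measurable with respect to the \<open>i\<close>-th one, and they are independent of each other
  by the splitting property.\<close>

section \<open>Independence of set systems: regrouping and reindexing\<close>

text \<open>Grouping a finite index set by blocks turns the probability of an intersection into a
  double product: independence of \<open>G\<close> separates the blocks, since
  intersection-stability puts each block's intersection into \<open>G j\<close>, and independence of
  \<open>H\<close> on \<open>K j\<close> splits each factor.\<close>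

lemma (in prob_space) indep_sets_refine:
  assumes G: "indep_sets G J" and stable: "\<And>j. j \<in> J \<Longrightarrow> Int_stable (G j)"
    and disj: "disjoint_family_on K J"
    and H: "\<And>j. j \<in> J \<Longrightarrow> indep_sets H (K j)"
    and sub: "\<And>j i. j \<in> J \<Longrightarrow> i \<in> K j \<Longrightarrow> H i \<subseteq> G j"
  shows "indep_sets H (\<Union>j\<in>J. K j)"
proof (rule indep_setsI)
  fix i assume "i \<in> (\<Union>j\<in>J. K j)"
  then show "H i \<subseteq> events" using H by (auto simp: indep_sets_def)
next
  fix A I assume I: "I \<noteq> {}" "I \<subseteq> (\<Union>j\<in>J. K j)" "finite I" and A: "\<forall>i\<in>I. A i \<in> H i"
  obtain g where g: "\<And>i. i \<in> I \<Longrightarrow> g i \<in> J \<and> i \<in> K (g i)"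
    using I(2) by (metis UN_E subsetD)
  have gK: "j = g i" if "i \<in> I" "i \<in> K j" "j \<in> J" for i j
    using disj g[OF that(1)] that by (auto simp: disjoint_family_on_def)
  \<comment> \<open>Only blocks that meet \<open>I\<close> are kept: over an empty index set the
    intersection would be \<open>UNIV\<close>, which need not belong to \<open>G j\<close>.\<close>
  define L where "L = g ` I"
  have L: "finite L" "L \<noteq> {}" "L \<subseteq> J" using I g by (auto simp: L_def)
  have ne: "I \<inter> K j \<noteq> {}" if "j \<in> L" for j using that g by (auto simp: L_def)
  have fib: "{i \<in> I. g i = j} = I \<inter> K j" if "j \<in> L" for j
    using that g gK L(3) by blast
  have inG: "(\<Inter>i\<in>I \<inter> K j. A i) \<in> G j" if j: "j \<in> L" for j
  proof -
    have Int: "(\<Inter>i\<in>B. A i) \<in> G j" if "finite B" "B \<noteq> {}" "B \<subseteq> I \<inter> K j" for B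
      using that
    proof (induction rule: finite_ne_induct)
      case (singleton x)
      then show ?case using A sub[of j x] j L(3) by auto
    next
      case (insert x F)
      then have "A x \<inter> (\<Inter>i\<in>F. A i) \<in> G j"
        using A sub j L(3) by (intro Int_stableD[OF stable]) auto
      then show ?case by simp
    qed
    show ?thesis by (rule Int) (use ne[OF j] I(3) in auto)
  qed
  have "(\<Inter>i\<in>I. A i) = (\<Inter>j\<in>L. \<Inter>i\<in>I \<inter> K j. A i)"
    using g by (auto simp: L_def)
  then have "prob (\<Inter>i\<in>I. A i) = (\<Prod>j\<in>L. prob (\<Inter>i\<in>I \<inter> K j. A i))"
    using indep_setsD[OF G L(3,2,1), of "\<lambda>j. \<Inter>i\<in>I \<inter> K j. A i"] inG by simp
  also have "\<dots> = (\<Prod>j\<in>L. \<Prod>i\<in>I \<inter> K j. prob (A i))"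
  proof (rule prod.cong[OF refl])
    fix j assume j: "j \<in> L"
    show "prob (\<Inter>i\<in>I \<inter> K j. A i) = (\<Prod>i\<in>I \<inter> K j. prob (A i))"
      using indep_setsD[OF H, of j "I \<inter> K j" A] j L(3) ne[OF j] I(3) A by auto
  qed
  \<comment> \<open>For \<open>j\<close> in \<open>L\<close> the set \<open>I \<inter> K j\<close>
    is a fibre of \<open>g\<close>, so the double product collapses to one over
    \<open>I\<close>.\<close>
  also have "\<dots> = (\<Prod>j\<in>L. \<Prod>i | i \<in> I \<and> g i = j. prob (A i))"
    by (intro prod.cong refl) (simp_all add: fib)
  also have "\<dots> = (\<Prod>i\<in>I. prob (A i))"
    unfolding L_def using prod.group[OF I(3), of "g ` I" g "\<lambda>i. prob (A i)"] I(3) by simp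
  finally show "prob (\<Inter>i\<in>I. A i) = (\<Prod>i\<in>I. prob (A i))" .
qed

text \<open>Injectivity lets a product over the image be read over the original indices. This moves
  families among \<open>bool\<close>, \<open>option\<close>, sum and natural number indices.\<close>

lemma (in prob_space) indep_sets_reindex:
  assumes inj: "inj_on f J" and ind: "indep_sets (\<lambda>j. H (f j)) J"
  shows "indep_sets H (f ` J)"
proof (rule indep_setsI)
  fix i assume "i \<in> f ` J"
  then show "H i \<subseteq> events" using ind by (auto simp: indep_sets_def)
next
  fix A I assume I: "I \<noteq> {}" "I \<subseteq> f ` J" "finite I" and A: "\<forall>i\<in>I. A i \<in> H i"
  then obtain L where L: "L \<subseteq> J" "finite L" "I = f ` L" by (meson finite_subset_image)
  then have "prob (\<Inter>j\<in>L. A (f j)) = (\<Prod>j\<in>L. prob (A (f j)))"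
    using indep_setsD[OF ind, of L "\<lambda>j. A (f j)"] I A by auto
  then show "prob (\<Inter>i\<in>I. A i) = (\<Prod>i\<in>I. prob (A i))"
    using L inj by (simp add: prod.reindex inj_on_subset image_image)
qed

lemma (in prob_space) indep_sets_singleton_iff: "indep_sets F {i} \<longleftrightarrow> F i \<subseteq> events"
proof
  assume "F i \<subseteq> events"
  then show "indep_sets F {i}"
    by (intro indep_setsI) (auto simp: subset_singleton_iff)
qed (simp add: indep_sets_def)

section \<open>Events generated by a random variable\<close>

lemma Int_stable_rv_events: "Int_stable (rv_events P N Y)"
proof (rule Int_stableI)
  fix a b assume "a \<in> rv_events P N Y" "b \<in> rv_events P N Y"
  then obtain A B where "A \<in> sets N" "B \<in> sets N"
    "a = Y -` A \<inter> space P" "b = Y -` B \<inter> space P"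
    by (auto simp: rv_events_def)
  then show "a \<inter> b \<in> rv_events P N Y"
    by (auto simp: rv_events_def intro!: exI[of _ "A \<inter> B"])
qed

text \<open>The tree recursion is assumed at points of the sample space only; this still lets a node
  be replaced by its formula in its system of events.\<close>

lemma rv_events_cong:
  "(\<And>\<omega>. \<omega> \<in> space P \<Longrightarrow> Y \<omega> = Z \<omega>) \<Longrightarrow> rv_events P N Y = rv_events P N Z"
  unfolding rv_events_def by (metis (no_types, lifting) vimage_inter_cong)

lemma has_law_cong:
  "(\<And>\<omega>. \<omega> \<in> space P \<Longrightarrow> Y \<omega> = Z \<omega>) \<Longrightarrow> has_law P Y L \<longleftrightarrow> has_law P Z L"
  unfolding has_law_def by (simp cong: measurable_cong distr_cong)

lemma rv_events_subset_sets: "Y \<in> measurable P N \<Longrightarrow> rv_events P N Y \<subseteq> sets P"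
  by (auto simp: rv_events_def)

text \<open>Preimages of measurable sets are among the generators \<open>E\<close>. When
  \<open>E\<close> consists of the events of a node and its source, both become measurable for the
  sigma-algebra they generate, and so do the children computed from them.\<close>

lemma measurable_sigma_rv_events:
  assumes "Y \<in> measurable P N" "rv_events P N Y \<subseteq> E" "E \<subseteq> Pow (space P)"
  shows "Y \<in> measurable (sigma (space P) E) N"
proof (rule measurableI)
  fix A assume "A \<in> sets N"
  then have "Y -` A \<inter> space P \<in> E" using assms(2) by (auto simp: rv_events_def)
  then show "Y -` A \<inter> space (sigma (space P) E) \<in> sets (sigma (space P) E)"
    using assms(3) by (simp add: space_measure_of_conv)
qed (use assms measurable_space in \<open>simp add: space_measure_of_conv\<close>)

section \<open>The independent family at a level of the tree\<close>

text \<open>\<open>Inl i\<close> stands for node \<open>i\<close> of level \<open>l\<close>,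
  \<open>Inr (k, i)\<close> for a source \<open>C k i\<close> not consumed in building the levels up
  to \<open>l\<close>. One index set thus covers real and \<open>'e\<close>-valued variables; at
  \<open>l = m\<close> only the nodes remain.\<close>

definition tree_index :: "nat \<Rightarrow> nat \<Rightarrow> (nat + nat \<times> nat) set" where
  "tree_index m l = Inl ` {..<2 ^ l} \<union> Inr ` {(k, i). l \<le> k \<and> k < m \<and> i < 2 ^ k}"

definition tree_events ::
  "'w measure \<Rightarrow> 'e measure \<Rightarrow> (nat \<Rightarrow> nat \<Rightarrow> 'w \<Rightarrow> 'e) \<Rightarrow> (nat \<Rightarrow> nat \<Rightarrow> 'w \<Rightarrow> real) \<Rightarrow> nat
    \<Rightarrow> nat + nat \<times> nat \<Rightarrow> 'w set set" where
  "tree_events M \<nu> C S l = case_sum (\<lambda>i. rv_events M borel (S l i)) (\<lambda>(k, i). rv_events M \<nu> (C k i))"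

lemma tree_events_simps [simp]:
  "tree_events M \<nu> C S l (Inl i) = rv_events M borel (S l i)"
  "tree_events M \<nu> C S l (Inr (k, i)) = rv_events M \<nu> (C k i)"
  by (simp_all add: tree_events_def)

lemma Int_stable_tree_events: "Int_stable (tree_events M \<nu> C S l j)"
  by (auto simp: tree_events_def Int_stable_rv_events split: sum.split)

section \<open>Passage to the next level\<close>

text \<open>The family keeps the sources still to be used, so that the step can be iterated. Both
  children are written through \<open>t\<close> as functions of the same pair, the form in which the
  splitting property speaks of them.\<close>

lemma tree_step:
  assumes M: "prob_space M" and l: "l < m"
    and \<theta>: "(\<lambda>(c, s). t c s) \<in> borel_measurable (\<nu> \<Otimes>\<^sub>M borel)"
    and split: "splitting X \<nu> n t"
    and C: "\<And>k i. k < m \<Longrightarrow> i < 2 ^ k \<Longrightarrow> has_law M (C k i) \<nu>"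
    and S0: "\<And>i \<omega>. i < 2 ^ l \<Longrightarrow> \<omega> \<in> space M \<Longrightarrow>
      S (Suc l) (2 * i) \<omega> = t (C l i \<omega>) (S l i \<omega>)"
    and S1: "\<And>i \<omega>. i < 2 ^ l \<Longrightarrow> \<omega> \<in> space M \<Longrightarrow>
      S (Suc l) (2 * i + 1) \<omega> = S l i \<omega> - t (C l i \<omega>) (S l i \<omega>)"
    and law: "\<And>i. i < 2 ^ l \<Longrightarrow> has_law M (S l i) (conv_power X (2 * n))"
    and ind: "prob_space.indep_sets M (tree_events M \<nu> C S l) (tree_index m l)"
  shows "prob_space.indep_sets M (tree_events M \<nu> C S (Suc l)) (tree_index m (Suc l))"
    and "i < 2 ^ Suc l \<Longrightarrow> has_law M (S (Suc l) i) (conv_power X n)"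
proof -
  interpret prob_space M by fact
  \<comment> \<open>\<open>J\<close> indexes blocks: one per node of level \<open>l\<close> and one
    per source of a later level. The old variables \<open>I j\<close> of a block, a node with its
    source or a lone source, give way to the new variables \<open>K j\<close>, the two children or
    the same source.\<close>
  define J :: "(nat + nat \<times> nat) set"
    where "J = Inl ` {..<2 ^ l} \<union> Inr ` {(k, i). Suc l \<le> k \<and> k < m \<and> i < 2 ^ k}"
  define I :: "nat + nat \<times> nat \<Rightarrow> (nat + nat \<times> nat) set"
    where "I = case_sum (\<lambda>i. {Inl i, Inr (l, i)}) (\<lambda>x. {Inr x})"
  define K :: "nat + nat \<times> nat \<Rightarrow> (nat + nat \<times> nat) set"
    where "K = case_sum (\<lambda>i. {Inl (2 * i), Inl (2 * i + 1)}) (\<lambda>x. {Inr x})"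
  define G where "G j = sigma_sets (space M) (\<Union>i\<in>I j. tree_events M \<nu> C S l i)" for j
  have UI: "(\<Union>j\<in>J. I j) = tree_index m l"
  proof -
    have "(\<Union>j\<in>J. I j) = Inl ` {..<2 ^ l} \<union>
        Inr ` (Pair l ` {..<2 ^ l} \<union> {(k, i). Suc l \<le> k \<and> k < m \<and> i < 2 ^ k})"
      by (auto simp: J_def I_def)
    also have "Pair l ` {..<2 ^ l} \<union> {(k, i). Suc l \<le> k \<and> k < m \<and> i < 2 ^ k}
        = {(k, i). l \<le> k \<and> k < m \<and> i < (2::nat) ^ k}"
      using l by (auto simp: Suc_le_eq le_less)
    finally show ?thesis by (simp add: tree_index_def)
  qed
  have UK: "(\<Union>j\<in>J. K j) = tree_index m (Suc l)"
  proof -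
    have "(\<Union>j\<in>J. K j) = Inl ` (\<Union>i\<in>{..<2 ^ l}. {2 * i, 2 * i + 1}) \<union>
        Inr ` {(k, i). Suc l \<le> k \<and> k < m \<and> i < 2 ^ k}"
      by (auto simp: J_def K_def)
    also have "(\<Union>i\<in>{..<2 ^ l}. {2 * i, 2 * i + 1}) = {..<(2::nat) ^ Suc l}"
    proof (intro equalityI subsetI)
      fix x :: nat assume "x \<in> {..<2 ^ Suc l}"
      \<comment> \<open>The parent of node \<open>x\<close> is \<open>x div 2\<close>.\<close>
      moreover have "x = 2 * (x div 2) \<or> x = 2 * (x div 2) + 1" by presburger
      ultimately show "x \<in> (\<Union>i\<in>{..<2 ^ l}. {2 * i, 2 * i + 1})"
        by (intro UN_I[of "x div 2"]) auto
    qed auto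
    finally show ?thesis by (simp add: tree_index_def)
  qed
  have G: "indep_sets G J"
    unfolding G_def
  proof (rule indep_sets_collect_sigma)
    show "indep_sets (tree_events M \<nu> C S l) (\<Union>j\<in>J. I j)" by (simp add: UI ind)
    show "disjoint_family_on I J"
      by (auto simp: disjoint_family_on_def I_def J_def)
  qed (rule Int_stable_tree_events)
  have stable: "Int_stable (G j)" if j: "j \<in> J" for j
  proof (rule Int_stableI)
    have "(\<Union>i\<in>I j. tree_events M \<nu> C S l i) \<subseteq> Pow (space M)"
      using sets.sets_into_space
      by (auto simp: tree_events_def rv_events_def split: sum.splits)
    then interpret sigma_algebra "space M" "G j" unfolding G_def by (rule sigma_algebra_sigma_sets)
    show "a \<inter> b \<in> G j" if "a \<in> G j" "b \<in> G j" for a b using that by blast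
  qed
  have children:
    "indep_sets (\<lambda>b. rv_events M borel (S (Suc l) (if b then 2 * i else 2 * i + 1))) UNIV"
    "has_law M (S (Suc l) (2 * i)) (conv_power X n)"
    "has_law M (S (Suc l) (2 * i + 1)) (conv_power X n)"
    "rv_events M borel (S (Suc l) (2 * i)) \<subseteq> G (Inl i)"
    "rv_events M borel (S (Suc l) (2 * i + 1)) \<subseteq> G (Inl i)" if i: "i < 2 ^ l" for i
  proof -
    have ind_i: "indep_set (rv_events M \<nu> (C l i)) (rv_events M borel (S l i))"
    proof (rule indep_setI)
      fix a b assume ab: "a \<in> rv_events M \<nu> (C l i)" "b \<in> rv_events M borel (S l i)"
      \<comment> \<open>Restricting the independent family to these two indices makes the node
        independent of its own source.\<close>
      have "{Inr (l, i), Inl i} \<subseteq> tree_index m l" using i l by (auto simp: tree_index_def)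
      from indep_setsD[OF ind this, of "case_sum (\<lambda>_. b) (\<lambda>_. a)"]
      show "prob (a \<inter> b) = prob a * prob b" using ab by simp
    next
      show "rv_events M \<nu> (C l i) \<subseteq> events"
        using C[OF l i] by (intro rv_events_subset_sets) (simp add: has_law_def)
      show "rv_events M borel (S l i) \<subseteq> events"
        using law[OF i] by (intro rv_events_subset_sets)
          (simp add: has_law_def cong: measurable_cong_sets)
    qed
    note sp = splitting_any_space[OF split \<theta> M law[OF i] C[OF l i] ind_i]
    have c0: "\<omega> \<in> space M \<Longrightarrow> S (Suc l) (2 * i) \<omega> = t (C l i \<omega>) (S l i \<omega>)"
      and c1: "\<omega> \<in> space M \<Longrightarrow> S (Suc l) (2 * i + 1) \<omega> = S l i \<omega> - t (C l i \<omega>) (S l i \<omega>)" for \<omega>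
      using S0 S1 i by blast+
    show "has_law M (S (Suc l) (2 * i)) (conv_power X n)"
      using sp(2) by (subst has_law_cong[OF c0])
    show "has_law M (S (Suc l) (2 * i + 1)) (conv_power X n)"
      using sp(3) by (subst has_law_cong[OF c1])
    \<comment> \<open>\<open>indep_var\<close> is independence over the index type
      \<open>bool\<close> with \<open>True\<close> for the first variable, so the child
      \<open>2 * i\<close> sits at \<open>True\<close>.\<close>
    have "indep_sets (\<lambda>b. rv_events M borel
        (if b then (\<lambda>\<omega>. t (C l i \<omega>) (S l i \<omega>)) else (\<lambda>\<omega>. S l i \<omega> - t (C l i \<omega>) (S l i \<omega>)))) UNIV"
      using sp(1)[unfolded indep_var_def indep_vars_def2, THEN conjunct2]
      by (rule indep_sets_cong[THEN iffD1, rotated -1]) (simp_all add: rv_events_def split: bool.split)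
    then show "indep_sets (\<lambda>b. rv_events M borel (S (Suc l) (if b then 2 * i else 2 * i + 1))) UNIV"
      by (rule indep_sets_cong[THEN iffD1, rotated -1])
        (simp_all add: rv_events_cong[OF c0] rv_events_cong[OF c1, simplified])
    define E where "E = (\<Union>i\<in>I (Inl i). tree_events M \<nu> C S l i)"
    have E: "E = rv_events M borel (S l i) \<union> rv_events M \<nu> (C l i)"
      by (simp add: E_def I_def)
    have EP: "E \<subseteq> Pow (space M)" by (auto simp: E rv_events_def)
    have [measurable]: "S l i \<in> borel_measurable (sigma (space M) E)"
      using law[OF i] by (intro measurable_sigma_rv_events EP)
        (auto simp: E has_law_def cong: measurable_cong_sets)
    have [measurable]: "C l i \<in> measurable (sigma (space M) E) \<nu>"
      using C[OF l i] by (intro measurable_sigma_rv_events EP) (auto simp: E has_law_def)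
    note \<theta>[measurable]
    have t[measurable]: "(\<lambda>\<omega>. t (C l i \<omega>) (S l i \<omega>)) \<in> borel_measurable (sigma (space M) E)"
      by measurable
    have d: "(\<lambda>\<omega>. S l i \<omega> - t (C l i \<omega>) (S l i \<omega>)) \<in> borel_measurable (sigma (space M) E)"
      by measurable
    \<comment> \<open>The measurable sets of \<open>sigma (space M) E\<close> are exactly
      \<open>G (Inl i)\<close>, so measurable functions of the node and its source have their events
      there.\<close>
    have ev: "rv_events M borel f \<subseteq> G (Inl i)" if "f \<in> borel_measurable (sigma (space M) E)"
      for f :: "'a \<Rightarrow> real"
      using measurable_sets[OF that] EP
      by (auto simp: rv_events_def G_def E_def[symmetric] space_measure_of_conv)
    show "rv_events M borel (S (Suc l) (2 * i)) \<subseteq> G (Inl i)"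
      using ev[OF t] by (subst rv_events_cong[OF c0])
    show "rv_events M borel (S (Suc l) (2 * i + 1)) \<subseteq> G (Inl i)"
      using ev[OF d] by (subst rv_events_cong[OF c1])
  qed
  show "has_law M (S (Suc l) i) (conv_power X n)" if "i < 2 ^ Suc l"
  proof -
    have "i div 2 < 2 ^ l" using that by auto
    moreover have "i = 2 * (i div 2) \<or> i = 2 * (i div 2) + 1" by presburger
    ultimately show ?thesis using children(2,3)[of "i div 2"] by metis
  qed
  \<comment> \<open>Independence between blocks comes from \<open>G\<close>, and inside a node block
    from the splitting property; a lone source is a block of one index, where only measurability is
    to be checked.\<close>
  have "indep_sets (tree_events M \<nu> C S (Suc l)) (\<Union>j\<in>J. K j)"
  proof (rule indep_sets_refine[OF G stable])
    show "disjoint_family_on K J"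
      by (auto simp: disjoint_family_on_def K_def J_def)
    fix j assume "j \<in> J"
    then consider i where "j = Inl i" "i < 2 ^ l" | k i where "j = Inr (k, i)" "k < m" "i < 2 ^ k"
      by (auto simp: J_def)
    then show "indep_sets (tree_events M \<nu> C S (Suc l)) (K j)"
    proof cases
      case 1
      let ?f = "\<lambda>b. Inl (if b then 2 * i else 2 * i + 1) :: nat + nat \<times> nat"
      have "indep_sets (\<lambda>b. tree_events M \<nu> C S (Suc l) (?f b)) UNIV"
        using children(1)[OF 1(2)] by simp
      from indep_sets_reindex[where f = ?f, OF _ this] show ?thesis
        by (simp add: K_def 1 UNIV_bool inj_on_def insert_commute)
    next
      case 2
      then show ?thesis
        using C[OF 2(2,3)]
        by (auto simp: K_def indep_sets_singleton_iff has_law_def rv_events_subset_sets)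
    qed
  next
    fix j i assume "j \<in> J" "i \<in> K j"
    then consider i' where "i' < 2 ^ l" "j = Inl i'" "i = Inl (2 * i') \<or> i = Inl (2 * i' + 1)"
      | k i' where "i = Inr (k, i')" "j = Inr (k, i')"
      by (auto simp: J_def K_def)
    then show "tree_events M \<nu> C S (Suc l) i \<subseteq> G j"
    proof cases
      case 1
      then show ?thesis using children(4,5)[OF 1(1)] by auto
    next
      \<comment> \<open>The events of a source are the same at both levels, and they generate
        \<open>G j\<close>.\<close>
      case 2
      then show ?thesis by (simp add: G_def I_def sigma_sets_superset_generator)
    qed
  qed
  then show "indep_sets (tree_events M \<nu> C S (Suc l)) (tree_index m (Suc l))" by (simp add: UK)
qed

section \<open>Induction over the levels\<close>

theorem theorem3:
  fixes m U :: nat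
    and X :: "real measure"
    and \<nu> :: "'e measure"
    and \<theta> :: "nat \<Rightarrow> 'e \<Rightarrow> real \<Rightarrow> real"
    and M :: "'w measure"
    and C :: "nat \<Rightarrow> nat \<Rightarrow> 'w \<Rightarrow> 'e"
    and S :: "nat \<Rightarrow> nat \<Rightarrow> 'w \<Rightarrow> real"
  assumes "m \<ge> 1" and "U = 2 ^ m"
    and "prob_space X" and "sets X = sets borel"
    and "prob_space \<nu>"
    and "\<And>k. k < m \<Longrightarrow> (\<lambda>(c, s). \<theta> (2 ^ k) c s) \<in> borel_measurable (\<nu> \<Otimes>\<^sub>M borel)"
    and "\<And>k. k < m \<Longrightarrow> splitting X \<nu> (2 ^ k) (\<theta> (2 ^ k))"
    and "prob_space M"
    and "has_law M (S 0 0) (conv_power X U)"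
    and "\<And>l i. l < m \<Longrightarrow> i < 2 ^ l \<Longrightarrow> has_law M (C l i) \<nu>"
    and "\<And>l i \<omega>. l < m \<Longrightarrow> i < 2 ^ l \<Longrightarrow> \<omega> \<in> space M \<Longrightarrow>
           S (l + 1) (2 * i) \<omega> = \<theta> (U div 2 ^ (l + 1)) (C l i \<omega>) (S l i \<omega>)"
    and "\<And>l i \<omega>. l < m \<Longrightarrow> i < 2 ^ l \<Longrightarrow> \<omega> \<in> space M \<Longrightarrow>
           S (l + 1) (2 * i + 1) \<omega> = S l i \<omega> - S (l + 1) (2 * i) \<omega>"
    and "prob_space.indep_sets M
           (\<lambda>j. case j of None \<Rightarrow> rv_events M borel (S 0 0)
                        | Some (l, i) \<Rightarrow> rv_events M \<nu> (C l i))
           (insert None (Some ` {(l, i). l < m \<and> i < 2 ^ l}))"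
  shows "\<forall>l. 1 \<le> l \<and> l \<le> m \<longrightarrow>
           prob_space.indep_vars M (\<lambda>_. borel) (S l) {..<2 ^ l} \<and>
           (\<forall>i<2 ^ l. has_law M (S l i) (conv_power X (U div 2 ^ l)))"
proof -
  interpret prob_space M by fact
  \<comment> \<open>Writing the convolution exponent as \<open>2 ^ (m - l)\<close> keeps the
    induction free of division; it equals \<open>U div 2 ^ l\<close> for
    \<open>l \<le> m\<close>.\<close>
  have inv: "indep_sets (tree_events M \<nu> C S l) (tree_index m l) \<and>
      (\<forall>i<2 ^ l. has_law M (S l i) (conv_power X (2 ^ (m - l))))" if "l \<le> m" for l
    using that
  proof (induction l)
    case 0
    \<comment> \<open>At level 0 the index \<open>None\<close> becomes the single node
      \<open>Inl 0\<close>, and every source is still to be used.\<close>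
    let ?f = "case_option (Inl 0) Inr :: (nat \<times> nat) option \<Rightarrow> nat + nat \<times> nat"
    let ?J = "insert None (Some ` {(l, i). l < m \<and> i < 2 ^ l})"
    have "indep_sets (\<lambda>j. tree_events M \<nu> C S 0 (?f j)) ?J"
      by (rule indep_sets_cong[THEN iffD1, rotated -1, OF assms(13)]) (auto split: option.split)
    then have "indep_sets (tree_events M \<nu> C S 0) (?f ` ?J)"
      by (rule indep_sets_reindex[rotated]) (auto simp: inj_on_def)
    also have "?f ` ?J = tree_index m 0"
      by (auto simp: tree_index_def image_image)
    finally show ?case using assms(2,9) by simp
  next
    case (Suc l)
    \<comment> \<open>Because \<open>l < m\<close>,
      \<open>2 ^ (m - l) = 2 * 2 ^ (m - Suc l)\<close>, so \<open>tree_step\<close> applies with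
      \<open>n = 2 ^ (m - Suc l)\<close>.\<close>
    then have l: "l < m" and IH: "indep_sets (tree_events M \<nu> C S l) (tree_index m l)"
      "\<And>i. i < 2 ^ l \<Longrightarrow> has_law M (S l i) (conv_power X (2 * 2 ^ (m - Suc l)))"
      by (simp_all add: power_Suc[symmetric] Suc_diff_Suc del: power_Suc)
    have U: "U div 2 ^ (l + 1) = 2 ^ (m - Suc l)"
      using l by (simp add: assms(2) power_diff[symmetric] del: power_Suc)
    have k: "m - Suc l < m" using l by simp
    have S0: "S (Suc l) (2 * i) \<omega> = \<theta> (2 ^ (m - Suc l)) (C l i \<omega>) (S l i \<omega>)"
      if "i < 2 ^ l" "\<omega> \<in> space M" for i \<omega>
      using assms(11)[OF l that] unfolding U by simp
    have S1: "S (Suc l) (2 * i + 1) \<omega> = S l i \<omega> - \<theta> (2 ^ (m - Suc l)) (C l i \<omega>) (S l i \<omega>)"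
      if "i < 2 ^ l" "\<omega> \<in> space M" for i \<omega>
      using assms(12)[OF l that] S0[OF that] by simp
    show ?case
      using tree_step[OF assms(8) l assms(6,7)[OF k] assms(10) S0 S1 IH(2,1)] by blast
  qed
  show ?thesis
  proof (intro allI impI)
    fix l assume "1 \<le> l \<and> l \<le> m"
    then have l: "l \<le> m" by simp
    have "random_variable borel (S l i)" if "i < 2 ^ l" for i
      using inv[OF l] that by (auto simp: has_law_def cong: measurable_cong_sets)
    moreover have "indep_sets (\<lambda>i. rv_events M borel (S l i)) {..<2 ^ l}"
    proof -
      \<comment> \<open>Passing to a subfamily discards the remaining sources; \<open>projl\<close>
        then returns the node indices to natural numbers.\<close>
      have "indep_sets (tree_events M \<nu> C S l) (Inl ` {..<2 ^ l})"
        using inv[OF l] by (auto simp: tree_index_def intro: indep_sets_mono_index)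
      then have "indep_sets (\<lambda>j :: nat + nat \<times> nat. rv_events M borel (S l (projl j))) (Inl ` {..<2 ^ l})"
        by (rule indep_sets_cong[THEN iffD1, rotated -1]) auto
      from indep_sets_reindex[where f = projl, OF _ this] show ?thesis
        by (simp add: image_image inj_on_def)
    qed
    ultimately show "indep_vars (\<lambda>_. borel) (S l) {..<2 ^ l} \<and>
        (\<forall>i<2 ^ l. has_law M (S l i) (conv_power X (U div 2 ^ l)))"
      using inv[OF l] l unfolding indep_vars_def2 rv_events_def
      by (simp add: assms(2) power_diff[symmetric])
  qed
qed

end
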